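(* For $n\geq 2$ let $m_n$ denote the minimum of $\|\lambda\|_2^2$ over all partitions $\lambda$ of $n$ with $\operatorname{rank}(\lambda)\geq 0$ (equivalently, the minimum of $x^{2}+r(a+1)^{2}+(x-1-r)a^{2}$ over integers $x\in\{2,\ldots,n\}$, where $n-x=a(x-1)+r$ with $a\in\mathbb{N}_0$, $0\leq r<x-1$, subject to $x\geq a$ if $r=0$ and $x\geq a+1$ otherwise). Then $m_n=\Theta(n^{4/3})$; more precisely, $$\frac{n^{4/3}}{4}\leq m_n\leq \left(2^{-2/3}+2^{1/3}\right)n^{4/3}\quad\text{for all } n\geq 28.$$
   Context: A partition of $n$ is a nonincreasing finite sequence $\lambda=(\lambda_1,\ldots,\lambda_k)$ of positive integers with sum $n$; $\|\lambda\|_2^2=\sum_i\lambda_i^2$; the rank of $\lambda$ is $\lambda_1-k$. $\mathbb{N}_0$ is the set of nonnegative integers. *)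

theory Defs
  imports Complex_Main "HOL-Library.Landau_Symbols"
begin

definition is_partition :: "nat \<Rightarrow> nat list \<Rightarrow> bool" where
  "is_partition n p \<longleftrightarrow> sorted_wrt (\<ge>) p \<and> (\<forall>i \<in> set p. i > 0) \<and> sum_list p = n"

definition sq_norm :: "nat list \<Rightarrow> nat" where
  "sq_norm p = (\<Sum>i\<leftarrow>p. i\<^sup>2)"

text \<open>Integer-valued, since ranks may be negative. Only meaningful for nonempty
  \<open>p\<close>, that is, for partitions of positive numbers.\<close>

definition rank :: "nat list \<Rightarrow> int" where
  "rank p = int (hd p) - int (length p)"

definition min_sq_norm :: "nat \<Rightarrow> nat" where
  "min_sq_norm n = Min {sq_norm p | p. is_partition n p \<and> rank p \<ge> 0}"

text \<open>For \<open>n > 0\<close>, \<^const>\<open>Min\<close> is a genuine minimum here: the set is finite and nonempty.\<close>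

lemma length_le_sum_list:
  "\<forall>i \<in> set p. (i::nat) > 0 \<Longrightarrow> length p \<le> sum_list p"
  by (induction p) auto

lemma finite_partitions: "finite {p. is_partition n p}"
proof (rule finite_subset)
  show "{p. is_partition n p} \<subseteq> {p. set p \<subseteq> {..n} \<and> length p \<le> n}"
    using length_le_sum_list member_le_sum_list by (fastforce simp: is_partition_def)
  show "finite {p. set p \<subseteq> {..n} \<and> length p \<le> n}"
    by (rule finite_lists_length_le) simp
qed

lemma finite_sq_norms: "finite {sq_norm p | p. is_partition n p \<and> rank p \<ge> 0}"
  by (rule finite_surj[OF finite_partitions, of _ sq_norm n]) auto

lemma sq_norms_nonempty:
  assumes "n > 0"
  shows "{sq_norm p | p. is_partition n p \<and> rank p \<ge> 0} \<noteq> {}"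
proof -
  have "is_partition n [n] \<and> rank [n] \<ge> 0"
    using assms by (auto simp: is_partition_def rank_def)
  then show ?thesis by blast
qed

text \<open>The truncating subtractions below are exact, because \<open>2 \<le> x \<le> n\<close> and \<open>r < x - 1\<close>.\<close>

definition param_values :: "nat \<Rightarrow> nat set" where
  "param_values n =
     {x\<^sup>2 + r * (a + 1)\<^sup>2 + (x - 1 - r) * a\<^sup>2 | x a r.
        x \<in> {2..n} \<and> n - x = a * (x - 1) + r \<and> r < x - 1 \<and>
        (if r = 0 then x \<ge> a else x \<ge> a + 1)}"

lemma finite_param_values: "finite (param_values n)"
proof (rule finite_subset)
  let ?f = "\<lambda>(x, a, r). x\<^sup>2 + r * (a + 1)\<^sup>2 + (x - 1 - r) * a\<^sup>2 :: nat"
  show "param_values n \<subseteq> ?f ` ({..n} \<times> {..n} \<times> {..n})"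
  proof
    fix v assume "v \<in> param_values n"
    then obtain x a r where v: "v = ?f (x, a, r)" and *: "x \<in> {2..n}" "r < x - 1"
      "if r = 0 then x \<ge> a else x \<ge> a + 1"
      by (auto simp: param_values_def)
    from * have "(x, a, r) \<in> {..n} \<times> {..n} \<times> {..n}"
      by (auto split: if_splits)
    with v show "v \<in> ?f ` ({..n} \<times> {..n} \<times> {..n})" by blast
  qed
qed simp

lemma param_values_nonempty:
  assumes "n \<ge> 2"
  shows "param_values n \<noteq> {}"
proof -
  have "n\<^sup>2 + 0 * (0 + 1)\<^sup>2 + (n - 1 - 0) * 0\<^sup>2 \<in> param_values n"
    unfolding param_values_def using assms
    by (intro CollectI exI[of _ n] exI[of _ 0]) auto
  then show ?thesis by blast
qed

end

theory Submission
  imports Defs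
begin

text \<open>Fix the largest part \<open>x\<close>. Padding the other parts with zeros gives \<open>x - 1\<close> numbers
  with sum \<open>n - x\<close>, and their sum of squares is least when they differ by at most one; this
  turns the minimum over partitions into the minimum over parameters. The resulting value lies
  within \<open>(x - 1) / 4\<close> above \<open>x\<^sup>2 + (n - x)\<^sup>2 / (x - 1)\<close>. For the lower bound, either \<open>x\<^sup>2\<close> or the
  quotient is large enough, according to whether \<open>x \<ge> n powr (2/3) / 2\<close>. For the upper bound, take
  \<open>x - 1\<close> to be the ceiling of the minimiser \<open>t\<close> of \<open>y\<^sup>2 + n\<^sup>2 / y\<close>, that is, \<open>2 * t ^ 3 = n\<^sup>2\<close>. The
  constant \<open>3 * 2 powr (-2/3)\<close> is the asymptotically exact one, and the rounding errors are absorbed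
  by the term \<open>- 2 * n\<close> in the expansion of \<open>(n - x)\<^sup>2 / (x - 1)\<close>.\<close>

section \<open>Reduction to the parametrised minimum\<close>

text \<open>The tangent-type bound \<open>(v - a) * (v - a - 1) \<ge> 0\<close> for integers \<open>v\<close>, summed over the list.\<close>

lemma sum_list_squares_ge:
  fixes a :: nat
  shows "(2 * a + 1) * sum_list q \<le> sq_norm q + length q * (a * (a + 1))"
proof (induction q)
  case Nil
  then show ?case by (simp add: sq_norm_def)
next
  case (Cons v q)
  have "(2 * a + 1) * v \<le> v\<^sup>2 + a * (a + 1)"
  proof (cases "v \<le> a")
    case True
    then obtain d where "a = v + d" using le_Suc_ex by blast
    then show ?thesis by (simp add: power2_eq_square algebra_simps)
  next
    case False
    then obtain d where "v = a + 1 + d"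
      by (metis Suc_eq_plus1 le_Suc_ex not_less_eq_eq)
    then show ?thesis by (simp add: power2_eq_square algebra_simps)
  qed
  with Cons show ?case by (simp add: sq_norm_def algebra_simps)
qed

text \<open>The tangent bound is an equality at the entries \<open>a\<close> and
  \<open>a + 1\<close>, so the left side equals
  \<open>(2 * a + 1) * (a * m + r) - m * (a * (a + 1))\<close>. Allowing \<open>length q\<close>
  below \<open>m\<close> stands for padding with zeros.\<close>

lemma balanced_le_sq_norm:
  assumes "length q \<le> m" "sum_list q = a * m + r" "r \<le> m"
  shows "r * (a + 1)\<^sup>2 + (m - r) * a\<^sup>2 \<le> sq_norm q"
proof -
  obtain d where m: "m = r + d" using assms(3) le_Suc_ex by blast
  have "(2 * a + 1) * (a * m + r) \<le> sq_norm q + length q * (a * (a + 1))"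
    using sum_list_squares_ge[of a q] assms(2) by simp
  also have "\<dots> \<le> sq_norm q + m * (a * (a + 1))"
    using assms(1) by simp
  finally show ?thesis
    by (simp add: m power2_eq_square algebra_simps)
qed

lemma param_value_le_sq_norm:
  assumes "n \<ge> 2" "is_partition n p" "rank p \<ge> 0"
  shows "\<exists>v\<in>param_values n. v \<le> sq_norm p"
proof -
  obtain x q where p: "p = x # q"
    using assms(1,2) by (cases p) (auto simp: is_partition_def)
  have len: "length q + 1 \<le> x" using assms(3) by (simp add: p rank_def)
  have sum: "x + sum_list q = n" and le: "\<forall>i\<in>set q. i \<le> x"
    using assms(2) by (auto simp: p is_partition_def)
  \<comment> \<open>If \<open>x = 1\<close>, nonnegative rank would force \<open>q = []\<close> and
    so \<open>n = 1\<close>.\<close>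
  have x: "2 \<le> x"
    using assms(1) len sum by (cases q) (auto simp: not_le)
  define a where "a = sum_list q div (x - 1)"
  define r where "r = sum_list q mod (x - 1)"
  have split: "sum_list q = a * (x - 1) + r" by (simp only: a_def r_def div_mult_mod_eq)
  have r: "r < x - 1" using x by (simp add: r_def)
  \<comment> \<open>At most \<open>x - 1\<close> further parts, each at most \<open>x\<close>: the
    average \<open>sum_list q / (x - 1)\<close> is at most \<open>x\<close>, which gives the side
    condition on \<open>a\<close>.\<close>
  have "sum_list q \<le> x * length q"
    using sum_list_mono[of q "\<lambda>i. i" "\<lambda>_. x"] le by (simp add: sum_list_triv mult.commute)
  also have "\<dots> \<le> x * (x - 1)" using len by (intro mult_left_mono) auto
  finally have bound: "a * (x - 1) + r \<le> x * (x - 1)" by (simp add: split)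
  have "if r = 0 then x \<ge> a else x \<ge> a + 1"
  proof (cases "r = 0")
    case True
    then show ?thesis using bound x by simp
  next
    case False
    then have "a * (x - 1) < x * (x - 1)" using bound by linarith
    then show ?thesis using False by simp
  qed
  then have "x\<^sup>2 + r * (a + 1)\<^sup>2 + (x - 1 - r) * a\<^sup>2 \<in> param_values n"
    unfolding param_values_def using x sum[symmetric] split r
    by (intro CollectI exI[of _ x] exI[of _ a] exI[of _ r]) simp
  moreover have "x\<^sup>2 + r * (a + 1)\<^sup>2 + (x - 1 - r) * a\<^sup>2 \<le> sq_norm p"
    using balanced_le_sq_norm[of q "x - 1" a r] len split r by (simp add: p sq_norm_def)
  ultimately show ?thesis by blast
qed

lemma param_value_is_sq_norm:
  assumes "v \<in> param_values n"
  shows "\<exists>p. v = sq_norm p \<and> is_partition n p \<and> rank p \<ge> 0"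
proof -
  obtain x a r where v: "v = x\<^sup>2 + r * (a + 1)\<^sup>2 + (x - 1 - r) * a\<^sup>2"
    and x: "2 \<le> x" "x \<le> n" and split: "n - x = a * (x - 1) + r" and r: "r < x - 1"
    and ax: "if r = 0 then x \<ge> a else x \<ge> a + 1"
    using assms by (auto simp: param_values_def)
  \<comment> \<open>For \<open>a = 0\<close> the smaller entries would be zeros, which are not
    parts. Dropping them changes neither sum nor squares and can only raise the rank.\<close>
  define p where
    "p = x # replicate r (a + 1) @ replicate (if a = 0 then 0 else x - 1 - r) a"
  obtain d where d: "x = r + d + 1"
    using r by (metis add.commute add.left_commute less_diff_conv less_imp_add_positive)
  have n: "n = x + a * (x - 1) + r" using split x by simp
  have "v = sq_norm p"
    by (simp add: v p_def sq_norm_def sum_list_replicate)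
  moreover have "is_partition n p"
    unfolding is_partition_def
  proof (intro conjI)
    show "sorted_wrt (\<ge>) p"
    proof -
      have "sorted_wrt (\<ge>) (replicate k (b::nat))" for k b by (induction k) auto
      then show ?thesis using ax by (auto simp: p_def sorted_wrt_append split: if_splits)
    qed
    show "\<forall>i\<in>set p. i > 0" using x by (auto simp: p_def)
    show "sum_list p = n"
      by (simp add: p_def n d sum_list_replicate algebra_simps)
  qed
  moreover have "rank p \<ge> 0" using r by (auto simp: rank_def p_def)
  ultimately show ?thesis by blast
qed

lemma min_sq_norm_eq_Min_param_values:
  assumes "n \<ge> 2"
  shows "min_sq_norm n = Min (param_values n)"
proof (rule antisym)
  let ?S = "{sq_norm p | p. is_partition n p \<and> rank p \<ge> 0}"
  have "param_values n \<subseteq> ?S" using param_value_is_sq_norm by blast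
  then show "min_sq_norm n \<le> Min (param_values n)"
    unfolding min_sq_norm_def
    using param_values_nonempty[OF assms] finite_sq_norms by (rule Min_antimono)
  have "Min ?S \<in> ?S" using assms by (intro Min_in finite_sq_norms sq_norms_nonempty) simp
  then obtain v where "v \<in> param_values n" "v \<le> Min ?S"
    using param_value_le_sq_norm[OF assms] by fastforce
  then show "Min (param_values n) \<le> min_sq_norm n"
    unfolding min_sq_norm_def using Min_le[OF finite_param_values] order_trans by blast
qed

section \<open>Asymptotic bounds\<close>

text \<open>For \<open>m\<close> numbers, \<open>m\<close> times the sum of squares is the squared
  sum plus the squared differences over all pairs; here \<open>r * (m - r)\<close> pairs differ,
  each by one.\<close>

lemma balanced_squares_identity:
  fixes a m r :: real
  shows "m * (r * (a + 1)\<^sup>2 + (m - r) * a\<^sup>2) = (a * m + r)\<^sup>2 + r * (m - r)"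
  by (simp add: power2_eq_square algebra_simps)

lemma param_value_lower:
  assumes "v \<in> param_values n"
  shows "real n powr (4/3) / 4 \<le> real v"
proof -
  obtain x a r where v: "v = x\<^sup>2 + r * (a + 1)\<^sup>2 + (x - 1 - r) * a\<^sup>2"
    and x: "2 \<le> x" "x \<le> n" and split: "n - x = a * (x - 1) + r" and r: "r < x - 1"
    using assms by (auto simp: param_values_def)
  define N where "N = real n"
  define X where "X = real x"
  define w where "w = N powr (2/3)"
  have N: "N \<ge> 2" and X: "X \<ge> 2" "X \<le> N" using x by (auto simp: N_def X_def)
  have w2: "w\<^sup>2 = N powr (4/3)" and w3: "w ^ 3 = N\<^sup>2"
    using N by (simp_all add: w_def powr_power)
  have wpos: "w > 0" using N by (simp add: w_def)
  have wN: "w \<le> N" unfolding w_def using N powr_mono[of "2/3" 1 N] by simp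
  define Q where "Q = real r * (real a + 1)\<^sup>2 + (X - 1 - real r) * (real a)\<^sup>2"
  have vQ: "real v = X\<^sup>2 + Q" using r x by (simp add: v X_def Q_def of_nat_diff add_ac)
  have S: "N - X = real a * (X - 1) + real r"
    using arg_cong[OF split, of real] x by (simp add: N_def X_def of_nat_diff)
  have rX: "real r \<le> X - 1" using r by (simp add: X_def)
  have Q0: "Q \<ge> 0" using rX by (simp add: Q_def)
  have "(X - 1) * Q = (N - X)\<^sup>2 + real r * (X - 1 - real r)"
    unfolding Q_def S by (rule balanced_squares_identity)
  then have "(N - X)\<^sup>2 \<le> (X - 1) * Q" using rX by simp
  also have "\<dots> \<le> X * Q" using Q0 by (simp add: mult_right_mono)
  finally have XQ: "(N - X)\<^sup>2 \<le> X * Q" .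
  have "w\<^sup>2 / 4 \<le> X\<^sup>2 + Q"
  proof (cases "X \<ge> w / 2")
    case True
    then have "(w / 2)\<^sup>2 \<le> X\<^sup>2" using wpos by (intro power_mono) auto
    then show ?thesis using Q0 by (simp add: power_divide)
  next
    case False
    \<comment> \<open>A small largest part leaves at least half of \<open>N\<close> to the other
      parts, whose squares then contribute \<open>w\<^sup>2 / 2\<close>, twice what is
      needed.\<close>
    then have "N / 2 \<le> N - X" using wN by simp
    then have "(N / 2)\<^sup>2 \<le> (N - X)\<^sup>2" using N by (intro power_mono) auto
    also note XQ
    also have "X * Q \<le> w / 2 * Q" using False Q0 by (intro mult_right_mono) auto
    finally have "w ^ 3 / 4 \<le> w / 2 * Q" using w3 by (simp add: power_divide)
    then have "w * (w\<^sup>2 / 2) \<le> w * Q" by (simp add: power2_eq_square power3_eq_cube)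
    then have "w\<^sup>2 / 2 \<le> Q" using wpos by simp
    then show ?thesis using zero_le_power2[of X] zero_le_power2[of w] by linarith
  qed
  then show ?thesis using w2 vQ by (simp add: N_def)
qed

text \<open>The left side has its minimum \<open>3 * t\<^sup>2\<close> at \<open>y = t\<close>, so
  the excess has the double factor \<open>(y - t)\<^sup>2\<close>, which is at most 1; the cofactor
  is at most 3 because \<open>t \<le> y\<close>.\<close>

lemma square_plus_quotient_le:
  fixes t y :: real
  assumes "0 < t" "t \<le> y" "y \<le> t + 1"
  shows "y\<^sup>2 + 2 * t ^ 3 / y \<le> 3 * t\<^sup>2 + 3"
proof -
  have "y\<^sup>2 + 2 * t ^ 3 / y - 3 * t\<^sup>2 = (y - t)\<^sup>2 * ((y + 2 * t) / y)"
    using assms by (simp add: field_simps power2_eq_square power3_eq_cube)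
  also have "\<dots> \<le> 1 * 3"
    using assms by (intro mult_mono) (auto simp: power_le_one divide_simps)
  finally show ?thesis by simp
qed

lemma param_value_upper:
  assumes "n \<ge> 28"
  shows "\<exists>v\<in>param_values n. real v \<le> (2 powr (-2/3) + 2 powr (1/3)) * real n powr (4/3)"
proof -
  define N where "N = real n"
  have N: "N \<ge> 28" using assms by (simp add: N_def)
  define t where "t = 2 powr (-1/3) * N powr (2/3)"
  have tpos: "t > 0" using N by (simp add: t_def)
  have t2: "t\<^sup>2 = 2 powr (-2/3) * N powr (4/3)"
    using N by (simp add: t_def power_mult_distrib powr_power)
  have "(2 powr (-1/3)) ^ 3 = (2::real) powr (-1)" by (subst powr_power) simp_all
  also have "\<dots> = 1 / 2" by (simp add: powr_neg_one)
  finally have half: "(2 powr (-1/3)) ^ 3 = (1 / 2 :: real)" .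
  have "(N powr (2/3)) ^ 3 = N powr 2" using N by (subst powr_power) simp_all
  then have t3: "2 * t ^ 3 = N\<^sup>2"
    using N unfolding t_def power_mult_distrib half by simp
  have "(2::real) powr (1/3) = 2 powr (1 + (-2/3))" by simp
  also have "\<dots> = 2 * 2 powr (-2/3)" by (subst powr_add) simp
  finally have const: "(2 powr (-2/3) + 2 powr (1/3)) * N powr (4/3) = 3 * t\<^sup>2"
    by (simp add: t2)
  \<comment> \<open>Comparing cubes, this needs only \<open>2 * N \<ge> 27\<close>.\<close>
  have tN: "t \<le> N / 3"
  proof (rule power_le_imp_le_base)
    have "27 * N\<^sup>2 \<le> (2 * N) * N\<^sup>2" using N by (intro mult_right_mono) auto
    then show "t ^ Suc 2 \<le> (N / 3) ^ Suc 2"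
      using t3 by (simp add: power_divide power2_eq_square power3_eq_cube field_simps)
  qed (use N in simp)
  \<comment> \<open>Needed for the side condition on \<open>a\<close>: it gives
    \<open>n \<le> m * m\<close>, so the quotient cannot exceed \<open>m + 1\<close>. Comparing
    cubes, \<open>N \<ge> 4\<close> suffices.\<close>
  have Nt: "N \<le> t\<^sup>2"
  proof (rule power_le_imp_le_base)
    have "4 * N ^ 3 \<le> N * N ^ 3" using N by (intro mult_right_mono) auto
    also have "\<dots> = (2 * t ^ 3)\<^sup>2" unfolding t3 by (simp add: power2_eq_square power3_eq_cube)
    finally show "N ^ Suc 2 \<le> (t\<^sup>2) ^ Suc 2"
      by (simp add: power_mult_distrib flip: power_mult)
  qed simp
  define m where "m = nat \<lceil>t\<rceil>"
  define y where "y = real m"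
  have y: "t \<le> y" "y \<le> t + 1" using tpos unfolding y_def m_def by linarith+
  have ypos: "y > 0" using y tpos by linarith
  define a where "a = (n - (m + 1)) div m"
  define r where "r = (n - (m + 1)) mod m"
  have m: "m > 0" using ypos by (simp add: y_def)
  have "y + 1 \<le> N" using y tN N by linarith
  then have mn: "m + 1 \<le> n" unfolding y_def N_def by linarith
  have split: "n - (m + 1) = a * m + r" by (simp add: a_def r_def)
  have r: "r < m" using m by (simp add: r_def)
  have "t\<^sup>2 \<le> y\<^sup>2" using y tpos by (intro power_mono) auto
  then have "real n \<le> real (m\<^sup>2)" using Nt unfolding N_def y_def of_nat_power by linarith
  then have "n \<le> m * m" by (simp only: of_nat_le_iff power2_eq_square)
  then have bound: "a * m + r \<le> (m + 1) * m" using split by (simp add: algebra_simps)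
  have "if r = 0 then m + 1 \<ge> a else m + 1 \<ge> a + 1"
  proof (cases "r = 0")
    case True
    then have "a * m \<le> (m + 1) * m" using bound by simp
    then show ?thesis using True m by (simp only: mult_le_cancel2) simp
  next
    case False
    then have "a * m < (m + 1) * m" using bound by linarith
    then show ?thesis using False by (simp only: mult_less_cancel2) simp
  qed
  then have mem: "(m + 1)\<^sup>2 + r * (a + 1)\<^sup>2 + (m + 1 - 1 - r) * a\<^sup>2 \<in> param_values n"
    unfolding param_values_def using m mn split r
    by (intro CollectI exI[of _ "m + 1"] exI[of _ a] exI[of _ r]) auto
  define Q where "Q = real r * (real a + 1)\<^sup>2 + (y - real r) * (real a)\<^sup>2"
  have S: "N - 1 - y = real a * y + real r"
    using arg_cong[OF split, of real] mn by (simp add: N_def y_def of_nat_diff)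
  have "y * Q = (N - 1 - y)\<^sup>2 + real r * (y - real r)"
    unfolding Q_def S by (rule balanced_squares_identity)
  also have "real r * (y - real r) \<le> y\<^sup>2 / 4"
    using zero_le_power2[of "y - 2 * real r"] by (simp add: power2_eq_square algebra_simps)
  finally have "Q \<le> ((N - 1 - y)\<^sup>2 + y\<^sup>2 / 4) / y"
    using ypos by (simp add: pos_le_divide_eq mult.commute)
  also have "\<dots> = N\<^sup>2 / y - (2 * N - 1) / y - 2 * N + 2 + 5 / 4 * y"
    using ypos by (simp add: power2_eq_square field_simps)
  also have "\<dots> \<le> N\<^sup>2 / y - 2 * N + 2 + 5 / 4 * y"
    using N ypos by simp
  finally have "(y + 1)\<^sup>2 + Q \<le> (y\<^sup>2 + N\<^sup>2 / y) + 13 / 4 * y + 3 - 2 * N"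
    by (simp add: power2_eq_square algebra_simps)
  also have "\<dots> \<le> 3 * t\<^sup>2 + 3 + 13 / 4 * y + 3 - 2 * N"
    using square_plus_quotient_le[OF tpos y] by (simp add: t3)
  \<comment> \<open>With \<open>y \<le> N / 3 + 1\<close>, the error \<open>13 / 4 * y + 6\<close>
    is at most \<open>13 / 12 * N + 37 / 4\<close>, which is below \<open>2 * N\<close> for
    \<open>N \<ge> 28\<close>.\<close>
  also have "\<dots> \<le> 3 * t\<^sup>2" using y tN N by linarith
  finally have "real ((m + 1)\<^sup>2 + r * (a + 1)\<^sup>2 + (m + 1 - 1 - r) * a\<^sup>2) \<le> 3 * t\<^sup>2"
    using r by (simp add: Q_def y_def of_nat_diff add_ac)
  with mem show ?thesis using const unfolding N_def by metis
qed

lemma min_sq_norm_lower: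
  assumes "n \<ge> 2"
  shows "real n powr (4/3) / 4 \<le> real (min_sq_norm n)"
  unfolding min_sq_norm_eq_Min_param_values[OF assms]
  by (intro param_value_lower Min_in finite_param_values param_values_nonempty assms)

lemma min_sq_norm_upper:
  assumes "n \<ge> 28"
  shows "real (min_sq_norm n) \<le> (2 powr (-2/3) + 2 powr (1/3)) * real n powr (4/3)"
proof -
  obtain v where "v \<in> param_values n"
    and v: "real v \<le> (2 powr (-2/3) + 2 powr (1/3)) * real n powr (4/3)"
    using param_value_upper[OF assms] by blast
  then have "min_sq_norm n \<le> v"
    using assms by (simp add: min_sq_norm_eq_Min_param_values finite_param_values)
  with v show ?thesis by linarith
qed

theorem theorem3:
  shows "(\<forall>n\<ge>2. min_sq_norm n = Min (param_values n)) \<and>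
    (\<lambda>n. real (min_sq_norm n)) \<in> \<Theta>(\<lambda>n. real n powr (4/3)) \<and>
    (\<forall>n\<ge>28. real n powr (4/3) / 4 \<le> real (min_sq_norm n) \<and>
      real (min_sq_norm n) \<le> (2 powr (-2/3) + 2 powr (1/3)) * real n powr (4/3))"
proof (intro conjI allI impI)
  let ?c = "2 powr (-2/3) + 2 powr (1/3) :: real"
  show "(\<lambda>n. real (min_sq_norm n)) \<in> \<Theta>(\<lambda>n. real n powr (4/3))"
  proof (rule bigthetaI)
    show "(\<lambda>n. real (min_sq_norm n)) \<in> O(\<lambda>n. real n powr (4/3))"
    proof (rule bigoI)
      show "\<forall>\<^sub>F n in sequentially. norm (real (min_sq_norm n)) \<le> ?c * norm (real n powr (4/3))"
        using eventually_ge_at_top[of 28] by eventually_elim (use min_sq_norm_upper in simp)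
    qed
    show "(\<lambda>n. real (min_sq_norm n)) \<in> \<Omega>(\<lambda>n. real n powr (4/3))"
    proof (rule landau_omega.bigI)
      show "\<forall>\<^sub>F n in sequentially. norm (real (min_sq_norm n)) \<ge> 1 / 4 * norm (real n powr (4/3))"
        using eventually_ge_at_top[of 2] by eventually_elim (use min_sq_norm_lower in simp)
    qed simp
  qed
qed (rule min_sq_norm_eq_Min_param_values min_sq_norm_lower min_sq_norm_upper; simp)+

end
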